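(* Let $\mathcal H$ be a Hilbert space and let $\{g_n\}_{n=0}^\infty$ be a normalized tight frame in $\mathcal H$ with $\|g_0\|=1$. Then there exists an effective sequence $\{e_n\}_{n=0}^\infty$ of unit vectors in $\mathcal H$ such that $$g_0=e_0,\qquad g_n=e_n-\sum_{i=0}^{n-1}\langle e_n,e_i\rangle g_i\quad (n\ge 1).$$
   Context: Hilbert spaces are complex, with inner product linear in the first variable. A sequence $\{g_n\}_{n=0}^\infty$ in $\mathcal H$ is a normalized tight frame if $\sum_{n=0}^\infty|\langle x,g_n\rangle|^2=\|x\|^2$ for all $x\in\mathcal H$. Given a sequence $\{e_n\}_{n=0}^\infty$ of unit vectors with dense linear span in $\mathcal H$ and $x\in\mathcal H$, the Kaczmarz algorithm defines $x_0=\langle x,e_0\rangle e_0$ and $x_n=x_{n-1}+\langle x-x_{n-1},e_n\rangle e_n$ for $n\ge1$. The sequence $\{e_n\}_{n=0}^\infty$ is effective if $x_n\to x$ in norm for every $x\in\mathcal H$. *)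

theory Defs
  imports "HOL-Analysis.Analysis"
begin

class complex_vector = real_vector +
  fixes scaleC :: "complex \<Rightarrow> 'a \<Rightarrow> 'a" (infixr \<open>*\<^sub>C\<close> 75)
  assumes scaleC_add_right: "a *\<^sub>C (x + y) = a *\<^sub>C x + a *\<^sub>C y"
    and scaleC_add_left: "(a + b) *\<^sub>C x = a *\<^sub>C x + b *\<^sub>C x"
    and scaleC_scaleC: "a *\<^sub>C (b *\<^sub>C x) = (a * b) *\<^sub>C x"
    and scaleC_one: "1 *\<^sub>C x = x"
    and scaleR_scaleC: "r *\<^sub>R x = complex_of_real r *\<^sub>C x"

global_interpretation complex_vector:
    vector_space "scaleC :: complex \<Rightarrow> 'a \<Rightarrow> 'a::complex_vector"
  defines cspan = complex_vector.span
  by unfold_locales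
    (simp_all add: scaleC_add_right scaleC_add_left scaleC_scaleC scaleC_one)

(* The real part of a complex inner product is a real inner product inducing the same norm.
   Building on real_inner makes the library's norm and topology the ones induced by cinner:
   positive definiteness of cinner comes from Re_cinner, see cinner_self and
   norm_eq_sqrt_cinner below. The product is linear in the first variable. *)
class complex_inner = complex_vector + real_inner +
  fixes cinner :: "'a \<Rightarrow> 'a \<Rightarrow> complex"
  assumes cinner_commute: "cinner x y = cnj (cinner y x)"
    and cinner_add_left: "cinner (x + y) z = cinner x z + cinner y z"
    and cinner_scaleC_left: "cinner (a *\<^sub>C x) y = a * cinner x y"
    and Re_cinner: "Re (cinner x y) = inner x y"

class chilbert_space = complex_inner + complete_space

lemma cinner_self: "cinner x x = complex_of_real ((norm x)\<^sup>2)"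
  for x :: "'a::complex_inner"
proof (rule complex_eqI)
  show "Re (cinner x x) = Re (complex_of_real ((norm x)\<^sup>2))"
    by (simp add: Re_cinner power2_norm_eq_inner)
  have "Im (cinner x x) = - Im (cinner x x)"
    using arg_cong[OF cinner_commute[of x x], of Im] by simp
  then show "Im (cinner x x) = Im (complex_of_real ((norm x)\<^sup>2))"
    by simp
qed

lemma norm_eq_sqrt_cinner: "norm x = sqrt (Re (cinner x x))"
  for x :: "'a::complex_inner"
  by (simp add: cinner_self)

instantiation complex :: chilbert_space
begin

definition scaleC_complex :: "complex \<Rightarrow> complex \<Rightarrow> complex"
  where "scaleC_complex a x = a * x"

definition cinner_complex :: "complex \<Rightarrow> complex \<Rightarrow> complex"
  where "cinner_complex x y = x * cnj y"

instance
  by standard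
    (simp_all add: scaleC_complex_def cinner_complex_def inner_complex_def
      scaleR_conv_of_real algebra_simps)

end

definition normalized_tight_frame :: "(nat \<Rightarrow> 'a::complex_inner) \<Rightarrow> bool"
  where "normalized_tight_frame g \<longleftrightarrow>
    (\<forall>x. (\<lambda>n. (cmod (cinner x (g n)))\<^sup>2) sums (norm x)\<^sup>2)"

primrec kaczmarz :: "(nat \<Rightarrow> 'a::complex_inner) \<Rightarrow> 'a \<Rightarrow> nat \<Rightarrow> 'a"
  where
    "kaczmarz e x 0 = cinner x (e 0) *\<^sub>C e 0"
  | "kaczmarz e x (Suc n) =
      kaczmarz e x n + cinner (x - kaczmarz e x n) (e (Suc n)) *\<^sub>C e (Suc n)"

definition effective :: "(nat \<Rightarrow> 'a::complex_inner) \<Rightarrow> bool"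
  where "effective e \<longleftrightarrow>
    (\<forall>n. norm (e n) = 1) \<and> closure (cspan (range e)) = UNIV \<and>
    (\<forall>x. kaczmarz e x \<longlonglongrightarrow> x)"

end

theory Submission
  imports Defs
begin

text \<open>
  Write \<open>R n x = x - kaczmarz e x n\<close> for the error after step \<open>n\<close>; it is the product of the
  projections along \<open>e 0, \<dots>, e n\<close>. Unfolding the recursion for \<open>g\<close> shows that it says exactly
  \<open>cinner x (g (n + 1)) = cinner (R n x) (e (n + 1))\<close> for all \<open>x\<close>: the frame coefficients of \<open>x\<close>
  are the coefficients of the successive corrections in the algorithm. A correction is orthogonal
  to the error that it leaves, so by Pythagoras
  \<open>(norm (R n x))\<^sup>2 = (norm x)\<^sup>2 - (\<Sum>i\<le>n. (cmod (cinner x (g i)))\<^sup>2)\<close>. For a normalized tight frame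
  the right-hand side tends to zero, and this is effectiveness.

  It remains to choose the unit vectors one by one. The same identity, together with the frame
  inequality, gives \<open>cmod (cinner x (g (n + 1))) \<le> norm (R n x)\<close>, so the functional \<open>cinner _ (g (n + 1))\<close>
  factors through \<open>R n\<close> as a contraction; by Riesz representation it equals \<open>cinner (R n _) u\<close>
  for some \<open>u\<close> with \<open>norm u \<le> 1\<close> in the closure of the range of \<open>R n\<close>
  (lemma \<open>riesz_along_linear_map\<close>). That range is orthogonal to
  \<open>e n\<close>, the direction projected out last. Hence adding a multiple of \<open>e n\<close> to \<open>u\<close> leaves the
  functional unchanged and can be used to bring the norm up to one
  (lemma \<open>unit_vector_representing_functional\<close>).
\<close>

section \<open>Complex inner products\<close>

lemma cinner_add_right: "cinner x (y + z) = cinner x y + cinner x z"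
  for x :: "'a::complex_inner"
  by (metis cinner_add_left cinner_commute complex_cnj_add)

lemma cinner_scaleC_right: "cinner x (a *\<^sub>C y) = cnj a * cinner x y"
  for x :: "'a::complex_inner"
  by (metis cinner_scaleC_left cinner_commute complex_cnj_mult)

lemma cinner_minus_left: "cinner (- x) y = - cinner x y"
  for x :: "'a::complex_inner"
  using cinner_scaleC_left[of "- 1" x y]
  by (simp add: complex_vector.scale_minus_left scaleC_one)

lemma cinner_diff_left: "cinner (x - y) z = cinner x z - cinner y z"
  for x :: "'a::complex_inner"
  using cinner_add_left[of x "- y" z] by (simp add: cinner_minus_left)

lemma cinner_diff_right: "cinner x (y - z) = cinner x y - cinner x z"
  for x :: "'a::complex_inner"
  by (metis cinner_diff_left cinner_commute complex_cnj_diff)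

lemma cinner_zero_left: "cinner 0 y = 0"
  for y :: "'a::complex_inner"
  using cinner_diff_left[of 0 0 y] by simp

lemma cinner_sum_left: "cinner (sum f A) y = (\<Sum>i\<in>A. cinner (f i) y)"
  for y :: "'a::complex_inner"
  by (induction A rule: infinite_finite_induct) (simp_all add: cinner_zero_left cinner_add_left)

lemma cinner_sum_right: "cinner y (sum f A) = (\<Sum>i\<in>A. cinner y (f i))"
  for y :: "'a::complex_inner"
  by (subst cinner_commute) (simp add: cinner_sum_left cinner_commute[of y])

lemma eq_if_cinner_eq:
  fixes y z :: "'a::complex_inner"
  assumes "\<And>x. cinner x y = cinner x z"
  shows "y = z"
proof -
  have "cinner (y - z) (y - z) = 0"
    using assms[of "y - z"] by (simp add: cinner_diff_right)
  then show ?thesis by (simp add: cinner_self)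
qed

lemma norm_scaleC: "norm (a *\<^sub>C x) = cmod a * norm x"
  for x :: "'a::complex_inner"
proof -
  have "complex_of_real ((norm (a *\<^sub>C x))\<^sup>2) = a * cnj a * complex_of_real ((norm x)\<^sup>2)"
    by (simp only: cinner_self[symmetric] cinner_scaleC_left cinner_scaleC_right mult.assoc mult.left_commute)
  also have "\<dots> = complex_of_real ((cmod a * norm x)\<^sup>2)"
    by (simp only: complex_norm_square[symmetric] power_mult_distrib of_real_mult of_real_power)
  finally have "(norm (a *\<^sub>C x))\<^sup>2 = (cmod a * norm x)\<^sup>2"
    using of_real_eq_iff by blast
  then show ?thesis by (simp add: power2_eq_iff_nonneg)
qed

lemma cinner_residual_of_projection:
  fixes y v :: "'a::complex_inner"
  assumes "norm v = 1"
  shows "cinner (y - cinner y v *\<^sub>C v) v = 0"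
  using assms by (simp add: cinner_diff_left cinner_scaleC_left cinner_self)

lemma norm_residual_of_projection:
  fixes y v :: "'a::complex_inner"
  assumes "norm v = 1"
  shows "(norm (y - cinner y v *\<^sub>C v))\<^sup>2 = (norm y)\<^sup>2 - (cmod (cinner y v))\<^sup>2"
proof -
  let ?p = "cinner y v *\<^sub>C v"
  have "inner (y - ?p) ?p = 0"
    using cinner_residual_of_projection[OF assms, of y]
    by (simp add: Re_cinner[symmetric] cinner_scaleC_right)
  then have "(norm ((y - ?p) + ?p))\<^sup>2 = (norm (y - ?p))\<^sup>2 + (norm ?p)\<^sup>2"
    by (simp only: power2_norm_eq_inner inner_add_left inner_add_right) (simp add: inner_commute)
  then show ?thesis using assms by (simp add: norm_scaleC)
qed

section \<open>Riesz representation along a linear map\<close>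

text \<open>
  The vector \<open>u\<close> is the limit of \<open>R (X k)\<close> for a sequence \<open>X\<close> that minimises
  \<open>\<phi> x = (norm (R x))\<^sup>2 - 2 * f x\<close>. By the parallelogram law \<open>R \<circ> X\<close> is Cauchy, and the first-order
  condition at the minimum is the representation of \<open>f\<close>. Taking the functional on the source of \<open>R\<close>
  means that neither a factorisation of \<open>f\<close> through the range nor an extension of it to the closure
  of the range has to be constructed.
\<close>

lemma riesz_along_linear_map:
  fixes R :: "'a::real_vector \<Rightarrow> 'b::{real_inner,complete_space}" and f :: "'a \<Rightarrow> real"
  assumes R: "linear R" and f: "linear f" and bound: "\<And>x. f x \<le> norm (R x)"
  shows "\<exists>u\<in>closure (range R). norm u \<le> 1 \<and> (\<forall>x. f x = inner (R x) u)"
proof -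
  define \<phi> where "\<phi> x = (norm (R x))\<^sup>2 - 2 * f x" for x
  define m where "m = Inf (range \<phi>)"
  have "- 1 \<le> \<phi> x" for x
    using bound[of x] zero_le_power2[of "norm (R x) - 1"]
    unfolding \<phi>_def power2_diff by simp
  then have "bdd_below (range \<phi>)" by (intro bdd_belowI2)
  then have m_le: "m \<le> \<phi> x" for x
    unfolding m_def by (simp add: cInf_lower)
  have "\<exists>x. \<phi> x < m + 1 / real (Suc k)" for k
    using cInf_lessD[of "range \<phi>" "m + 1 / real (Suc k)"] by (auto simp: m_def)
  then obtain X where X: "\<And>k. \<phi> (X k) < m + 1 / real (Suc k)" by metis
  have parallelogram: "(norm (R x - R y))\<^sup>2 = 2 * \<phi> x + 2 * \<phi> y - 4 * \<phi> ((1/2) *\<^sub>R (x + y))" for x y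
    unfolding \<phi>_def power2_norm_eq_inner
    by (simp add: linear_add[OF R] linear_add[OF f] linear_scale[OF R] linear_scale[OF f]
        inner_add_left inner_add_right inner_diff_left inner_diff_right inner_commute algebra_simps)
  have close: "(norm (R (X k) - R (X l)))\<^sup>2 < 4 / real (Suc N)" if "N \<le> k" "N \<le> l" for k l N
  proof -
    have "1 / real (Suc k) \<le> 1 / real (Suc N)" "1 / real (Suc l) \<le> 1 / real (Suc N)"
      using that by (simp_all add: frac_le)
    then show ?thesis
      using parallelogram[of "X k" "X l"] m_le[of "(1/2) *\<^sub>R (X k + X l)"] X[of k] X[of l]
      by simp
  qed
  have "Cauchy (\<lambda>k. R (X k))"
  proof (rule CauchyI)
    fix r :: real assume "0 < r"
    then obtain N where N: "1 / real (Suc N) < r\<^sup>2 / 4"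
      using nat_approx_posE[of "r\<^sup>2 / 4"] by auto
    have "norm (R (X k) - R (X l)) < r" if "N \<le> k" "N \<le> l" for k l
    proof -
      have "(norm (R (X k) - R (X l)))\<^sup>2 < r\<^sup>2"
        using close[OF that] N by simp
      then show ?thesis using \<open>0 < r\<close> by (simp add: power2_less_imp_less)
    qed
    then show "\<exists>N. \<forall>k\<ge>N. \<forall>l\<ge>N. norm (R (X k) - R (X l)) < r" by blast
  qed
  then obtain u where lim: "(\<lambda>k. R (X k)) \<longlonglongrightarrow> u"
    using Cauchy_convergent convergent_def by blast
  have inner_u: "f x = inner (R x) u" for x
  proof -
    have variation: "0 \<le> 2 * t * (inner (R x) u - f x) + t\<^sup>2 * (norm (R x))\<^sup>2" for t
    proof -
      have "- (1 / real (Suc k)) \<le> 2 * t * (inner (R x) (R (X k)) - f x) + t\<^sup>2 * (norm (R x))\<^sup>2" for k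
      proof -
        have "\<phi> (X k + t *\<^sub>R x) = \<phi> (X k) + 2 * t * (inner (R x) (R (X k)) - f x) + t\<^sup>2 * (norm (R x))\<^sup>2"
          unfolding \<phi>_def power2_norm_eq_inner
          by (simp add: linear_add[OF R] linear_add[OF f] linear_scale[OF R] linear_scale[OF f]
              inner_add_left inner_add_right inner_commute algebra_simps power2_eq_square)
        then show ?thesis using m_le[of "X k + t *\<^sub>R x"] X[of k] by simp
      qed
      moreover have "(\<lambda>k. - (1 / real (Suc k))) \<longlonglongrightarrow> 0"
        using tendsto_minus[OF LIMSEQ_Suc[OF lim_1_over_n]] by simp
      moreover have "(\<lambda>k. 2 * t * (inner (R x) (R (X k)) - f x) + t\<^sup>2 * (norm (R x))\<^sup>2)
          \<longlonglongrightarrow> 2 * t * (inner (R x) u - f x) + t\<^sup>2 * (norm (R x))\<^sup>2"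
        by (intro tendsto_intros lim)
      ultimately show ?thesis by (meson LIMSEQ_le)
    qed
    \<comment> \<open>A step against the sign of the slope \<open>d\<close>, short enough that the quadratic term
      cannot compensate, would make the right-hand side of \<open>variation\<close> negative unless \<open>d = 0\<close>.\<close>
    define d where "d = inner (R x) u - f x"
    define q where "q = (norm (R x))\<^sup>2 + 1"
    have "0 < q" by (simp add: q_def add_nonneg_pos)
    have "0 \<le> 2 * (- d / q) * d + (- d / q)\<^sup>2 * q"
      using variation[of "- d / q"] by (simp add: d_def q_def algebra_simps add_increasing2)
    also have "\<dots> = - (d\<^sup>2 / q)"
      using \<open>0 < q\<close> by (simp add: field_simps power2_eq_square)
    finally have "d\<^sup>2 \<le> 0" using \<open>0 < q\<close> by (simp add: divide_le_0_iff)
    then show ?thesis by (simp add: d_def)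
  qed
  have "inner u u \<le> norm u"
  proof (rule LIMSEQ_le)
    show "(\<lambda>k. inner (R (X k)) u) \<longlonglongrightarrow> inner u u" "(\<lambda>k. norm (R (X k))) \<longlonglongrightarrow> norm u"
      by (intro tendsto_intros lim)+
    show "\<exists>N. \<forall>k\<ge>N. inner (R (X k)) u \<le> norm (R (X k))"
      using bound by (simp add: inner_u[symmetric])
  qed
  then have "norm u * norm u \<le> norm u * 1"
    by (simp add: power2_norm_eq_inner[symmetric] power2_eq_square)
  then have "norm u \<le> 1"
    by (cases "norm u = 0") (simp_all add: mult_le_cancel_left)
  moreover have "u \<in> closure (range R)"
    using lim unfolding closure_sequential by (intro exI[of _ "\<lambda>k. R (X k)"]) simp
  ultimately show ?thesis using inner_u by blast
qed

abbreviation clinear :: "('a::complex_vector \<Rightarrow> 'b::complex_vector) \<Rightarrow> bool"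
  where "clinear \<equiv> Vector_Spaces.linear scaleC scaleC"

lemma clinearI:
  fixes R :: "'a::complex_vector \<Rightarrow> 'b::complex_vector"
  assumes "\<And>x y. R (x + y) = R x + R y" and "\<And>a x. R (a *\<^sub>C x) = a *\<^sub>C R x"
  shows "clinear R"
  using assms by unfold_locales auto

lemma clinear_add: "clinear R \<Longrightarrow> R (x + y) = R x + R y"
  by (simp add: Vector_Spaces.linear_iff)

lemma clinear_scaleC: "clinear R \<Longrightarrow> R (a *\<^sub>C x) = a *\<^sub>C R x"
  by (simp add: Vector_Spaces.linear_iff)

lemma clinear_residual:
  fixes R :: "'a::complex_vector \<Rightarrow> 'b::complex_inner"
  assumes "clinear R"
  shows "clinear (\<lambda>x. R x - cinner (R x) v *\<^sub>C v)"
  by (rule clinearI)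
    (simp_all add: clinear_add[OF assms] clinear_scaleC[OF assms] cinner_add_left
      cinner_scaleC_left scaleC_add_left complex_vector.scale_right_diff_distrib scaleC_scaleC)

text \<open>
  Only the real part of the functional is represented by Riesz; complex linearity of \<open>R\<close> recovers
  the imaginary part, because \<open>Im z = - Re (\<i> * z)\<close>. The unit vector \<open>w\<close> is invisible to the
  functional \<open>cinner (R _)\<close> and so provides the room needed to normalise.
\<close>

lemma unit_vector_representing_functional:
  fixes R :: "'a::complex_inner \<Rightarrow> 'b::chilbert_space"
  assumes R: "clinear R"
    and w: "norm w = 1" "\<And>x. cinner (R x) w = 0"
    and bound: "\<And>x. cmod (cinner x h) \<le> norm (R x)"
  shows "\<exists>v. norm v = 1 \<and> (\<forall>x. cinner x h = cinner (R x) v)"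
proof -
  have "linear R"
    by (rule linearI) (simp_all add: clinear_add[OF R] clinear_scaleC[OF R] scaleR_scaleC)
  moreover have "linear (\<lambda>x. inner x h)"
    by (rule linearI) (simp_all add: inner_add_left)
  moreover have "inner x h \<le> norm (R x)" for x
    using complex_Re_le_cmod[of "cinner x h"] bound[of x] by (simp add: Re_cinner)
  ultimately obtain u where u: "u \<in> closure (range R)" "norm u \<le> 1"
    "\<And>x. inner x h = inner (R x) u"
    using riesz_along_linear_map by blast
  have represents: "cinner x h = cinner (R x) u" for x
  proof (rule complex_eqI)
    show "Re (cinner x h) = Re (cinner (R x) u)"
      by (simp add: Re_cinner u(3))
    have "Re (cinner (\<i> *\<^sub>C x) h) = Re (cinner (R (\<i> *\<^sub>C x)) u)"
      by (simp only: Re_cinner u(3))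
    then show "Im (cinner x h) = Im (cinner (R x) u)"
      by (simp add: clinear_scaleC[OF R] cinner_scaleC_left)
  qed
  have "inner u w = 0"
  proof -
    have "range R \<subseteq> {y. inner w y = 0}"
      using w(2) by (auto simp: inner_commute[of w] Re_cinner[of _ w, symmetric])
    then have "closure (range R) \<subseteq> {y. inner w y = 0}"
      by (rule closure_minimal) (rule closed_hyperplane)
    then show ?thesis using u(1) by (auto simp: inner_commute)
  qed
  define t where "t = sqrt (1 - (norm u)\<^sup>2)"
  have "(norm u)\<^sup>2 \<le> 1" using u(2) by (simp add: power_le_one)
  then have t: "t\<^sup>2 = 1 - (norm u)\<^sup>2" by (simp add: t_def)
  have "(norm (u + t *\<^sub>R w))\<^sup>2 = (norm u)\<^sup>2 + t\<^sup>2 * (norm w)\<^sup>2"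
    using \<open>inner u w = 0\<close> unfolding power2_norm_eq_inner
    by (simp add: inner_add_left inner_add_right inner_commute power2_eq_square)
  then have "(norm (u + t *\<^sub>R w))\<^sup>2 = 1" using t w(1) by simp
  then have "norm (u + t *\<^sub>R w) = 1" using norm_ge_zero[of "u + t *\<^sub>R w"]
    unfolding power2_eq_1_iff by linarith
  moreover have "cinner x h = cinner (R x) (u + t *\<^sub>R w)" for x
    by (simp add: represents cinner_add_right scaleR_scaleC cinner_scaleC_right w(2))
  ultimately show ?thesis by blast
qed

section \<open>Kaczmarz sequences from tight frames\<close>

text \<open>
  Dependent choice over pairs of the current vector \<open>e n\<close> and the error operator \<open>R n\<close>; the
  operator is carried along because it is all that the next choice depends on.
\<close>

lemma exists_unit_vectors_with_residuals:
  fixes g :: "nat \<Rightarrow> 'a::chilbert_space"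
  assumes bessel: "\<And>n x. (\<Sum>i\<le>n. (cmod (cinner x (g i)))\<^sup>2) \<le> (norm x)\<^sup>2"
    and g0: "norm (g 0) = 1"
  shows "\<exists>(e :: nat \<Rightarrow> 'a) R. e 0 = g 0 \<and> (\<forall>n. norm (e n) = 1) \<and>
    (\<forall>x. R 0 x = x - cinner x (g 0) *\<^sub>C g 0) \<and>
    (\<forall>n x. cinner x (g (Suc n)) = cinner (R n x) (e (Suc n))) \<and>
    (\<forall>n x. R (Suc n) x = R n x - cinner (R n x) (e (Suc n)) *\<^sub>C e (Suc n)) \<and>
    (\<forall>n x. (norm (R n x))\<^sup>2 = (norm x)\<^sup>2 - (\<Sum>i\<le>n. (cmod (cinner x (g i)))\<^sup>2))"
proof -
  define P where "P n s \<longleftrightarrow> (case s of (v, R) \<Rightarrow> norm v = 1 \<and> clinear R \<and> (\<forall>x. cinner (R x) v = 0) \<and>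
      (\<forall>x. (norm (R x))\<^sup>2 = (norm x)\<^sup>2 - (\<Sum>i\<le>n. (cmod (cinner x (g i)))\<^sup>2)) \<and>
      (n = 0 \<longrightarrow> v = g 0 \<and> R = (\<lambda>x. x - cinner x (g 0) *\<^sub>C g 0)))"
    for n and s :: "'a \<times> ('a \<Rightarrow> 'a)"
  define Q where "Q n s s' \<longleftrightarrow> (\<forall>x. cinner x (g (Suc n)) = cinner (snd s x) (fst s')) \<and>
      snd s' = (\<lambda>x. snd s x - cinner (snd s x) (fst s') *\<^sub>C fst s')"
    for n and s s' :: "'a \<times> ('a \<Rightarrow> 'a)"
  have start: "P 0 (g 0, \<lambda>x. x - cinner x (g 0) *\<^sub>C g 0)"
  proof -
    have "clinear (\<lambda>x :: 'a. x)" by (rule clinearI) simp_all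
    from clinear_residual[OF this, of "g 0"] show ?thesis
      using g0 by (simp add: P_def cinner_residual_of_projection norm_residual_of_projection)
  qed
  have extend: "\<exists>s'. P (Suc n) s' \<and> Q n s s'" if s: "P n s" for n s
  proof -
    obtain w R where [simp]: "s = (w, R)" by (cases s)
    have R: "clinear R" and w: "norm w = 1" "\<And>x. cinner (R x) w = 0"
      and norm_R: "\<And>x. (norm (R x))\<^sup>2 = (norm x)\<^sup>2 - (\<Sum>i\<le>n. (cmod (cinner x (g i)))\<^sup>2)"
      using s by (auto simp: P_def)
    have "cmod (cinner x (g (Suc n))) \<le> norm (R x)" for x
    proof (rule power2_le_imp_le)
      show "(cmod (cinner x (g (Suc n))))\<^sup>2 \<le> (norm (R x))\<^sup>2"
        using bessel[of x "Suc n"] by (simp add: norm_R)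
    qed simp
    then obtain v where v: "norm v = 1" "\<And>x. cinner x (g (Suc n)) = cinner (R x) v"
      using unit_vector_representing_functional[OF R w] by blast
    let ?s' = "(v, \<lambda>x. R x - cinner (R x) v *\<^sub>C v)"
    have "P (Suc n) ?s'"
      using v(1) clinear_residual[OF R, of v]
      by (simp add: P_def cinner_residual_of_projection norm_residual_of_projection norm_R v(2))
    moreover have "Q n s ?s'" by (simp add: Q_def v(2))
    ultimately show ?thesis by blast
  qed
  obtain S where S: "\<And>n. P n (S n)" "\<And>n. Q n (S n) (S (Suc n))"
    using dependent_nat_choice[of P Q] start extend by blast
  show ?thesis
  proof (intro exI conjI allI)
    show "fst (S 0) = g 0" "snd (S 0) x = x - cinner x (g 0) *\<^sub>C g 0" for x
      using S(1)[of 0] by (auto simp: P_def split: prod.splits)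
    fix n x
    show "norm (fst (S n)) = 1"
      "(norm (snd (S n) x))\<^sup>2 = (norm x)\<^sup>2 - (\<Sum>i\<le>n. (cmod (cinner x (g i)))\<^sup>2)"
      using S(1)[of n] by (auto simp: P_def split: prod.splits)
    show "cinner x (g (Suc n)) = cinner (snd (S n) x) (fst (S (Suc n)))"
      "snd (S (Suc n)) x = snd (S n) x - cinner (snd (S n) x) (fst (S (Suc n))) *\<^sub>C fst (S (Suc n))"
      using S(2)[of n] by (simp_all add: Q_def)
  qed
qed

lemma kaczmarz_in_cspan: "kaczmarz e x n \<in> cspan (range e)"
  by (induction n)
    (simp_all add: complex_vector.span_add complex_vector.span_scale complex_vector.span_base)

lemma effectiveI:
  fixes e :: "nat \<Rightarrow> 'a::complex_inner"
  assumes "\<And>n. norm (e n) = 1" and lim: "\<And>x. kaczmarz e x \<longlonglongrightarrow> x"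
  shows "effective e"
proof -
  have "x \<in> closure (cspan (range e))" for x
    unfolding closure_sequential using kaczmarz_in_cspan lim by blast
  then show ?thesis using assms by (auto simp: effective_def)
qed

theorem corollary1:
  fixes g :: "nat \<Rightarrow> 'a::chilbert_space"
  assumes "normalized_tight_frame g"
    and "norm (g 0) = 1"
  shows "\<exists>e :: nat \<Rightarrow> 'a. (\<forall>n. norm (e n) = 1) \<and> effective e \<and>
    g 0 = e 0 \<and>
    (\<forall>n\<ge>1. g n = e n - (\<Sum>i<n. cinner (e n) (e i) *\<^sub>C g i))"
proof -
  have sums: "(\<lambda>n. (cmod (cinner x (g n)))\<^sup>2) sums (norm x)\<^sup>2" for x
    using assms(1) by (simp add: normalized_tight_frame_def)
  have "(\<Sum>i\<le>n. (cmod (cinner x (g i)))\<^sup>2) \<le> (norm x)\<^sup>2" for n x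
    using sum_le_suminf[OF sums_summable[OF sums[of x]], of "{..n}"] sums_unique[OF sums[of x]]
    by simp
  from exists_unit_vectors_with_residuals[OF this assms(2)] obtain e R where
    e0: "e 0 = g 0" and unit: "\<And>n. norm (e n) = (1::real)"
    and R0: "\<And>x. R 0 x = x - cinner x (g 0) *\<^sub>C g 0"
    and coeff: "\<And>n x. cinner x (g (Suc n)) = cinner (R n x) (e (Suc n))"
    and R_Suc: "\<And>n x. R (Suc n) x = R n x - cinner (R n x) (e (Suc n)) *\<^sub>C e (Suc n)"
    and norm_R: "\<And>n x. (norm (R n x))\<^sup>2 = (norm x)\<^sup>2 - (\<Sum>i\<le>n. (cmod (cinner x (g i)))\<^sup>2)"
    by auto
  have R_kaczmarz: "R n x = x - kaczmarz e x n" for n x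
    by (induction n) (simp_all add: R0 R_Suc e0)
  have expansion: "kaczmarz e x n = (\<Sum>i<Suc n. cinner x (g i) *\<^sub>C e i)" for n x
    by (induction n) (simp_all add: e0 coeff R_kaczmarz)
  have "g (Suc n) = e (Suc n) - (\<Sum>i<Suc n. cinner (e (Suc n)) (e i) *\<^sub>C g i)" for n
  proof (rule eq_if_cinner_eq)
    fix x
    have "cinner x (g (Suc n)) = cinner (x - (\<Sum>i<Suc n. cinner x (g i) *\<^sub>C e i)) (e (Suc n))"
      by (simp only: coeff R_kaczmarz expansion)
    also have "\<dots> = cinner x (e (Suc n)) - (\<Sum>i<Suc n. cinner x (g i) * cinner (e i) (e (Suc n)))"
      by (simp only: cinner_diff_left cinner_sum_left cinner_scaleC_left)
    also have "\<dots> = cinner x (e (Suc n))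
        - (\<Sum>i<Suc n. cnj (cinner (e (Suc n)) (e i)) * cinner x (g i))"
      by (simp only: cinner_commute[symmetric] mult.commute)
    also have "\<dots> = cinner x (e (Suc n) - (\<Sum>i<Suc n. cinner (e (Suc n)) (e i) *\<^sub>C g i))"
      by (simp only: cinner_diff_right cinner_sum_right cinner_scaleC_right)
    finally show "cinner x (g (Suc n))
        = cinner x (e (Suc n) - (\<Sum>i<Suc n. cinner (e (Suc n)) (e i) *\<^sub>C g i))" .
  qed
  then have recursion: "g n = e n - (\<Sum>i<n. cinner (e n) (e i) *\<^sub>C g i)" if "n \<ge> 1" for n
    using that by (cases n) auto
  have "kaczmarz e x \<longlonglongrightarrow> x" for x
  proof -
    have "(\<lambda>n. \<Sum>i\<le>n. (cmod (cinner x (g i)))\<^sup>2) \<longlonglongrightarrow> (norm x)\<^sup>2"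
      using sums by (simp add: sums_def_le)
    from tendsto_diff[OF tendsto_const[of "(norm x)\<^sup>2"] this]
    have "(\<lambda>n. (norm (x - kaczmarz e x n))\<^sup>2) \<longlonglongrightarrow> 0"
      by (simp add: norm_R R_kaczmarz[symmetric])
    from tendsto_real_sqrt[OF this] have "(\<lambda>n. norm (kaczmarz e x n - x)) \<longlonglongrightarrow> 0"
      by (simp add: norm_minus_commute)
    then show ?thesis by (simp add: tendsto_norm_zero_iff LIM_zero_iff)
  qed
  then have "effective e" using unit by (intro effectiveI)
  then show ?thesis using unit e0[symmetric] recursion by blast
qed

end
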